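(* Let $\varphi_{(\alpha,q_o)}$ be an OT-ruled surface with Weingarten map coefficients $A_1,A_2,B_1,B_2$. (i) The parameter curves $\vec\varphi_{(\alpha,q_o)}(s,u_0)$ ($u_0$ constant) are lines of curvature if and only if $A_2=0$, or equivalently, $$(f^2+g^2)(f\mu+g\eta+\xi\cos\theta)+g^2\cos\theta\left(\frac{f}{g}\right)_{s}=0$$ holds. (ii) The parameter curves $\vec\varphi_{(\alpha,q_o)}(s_0,u)$ ($s_0$ constant) are lines of curvature if and only if $B_1=0$, or equivalently, the OT-ruled surface $\varphi_{(\alpha,q_o)}$ is a plane or $\varphi_{(\alpha,q_o)}=\varphi_{(\alpha,T)}$.
   Context: Let $\alpha:I\to\mathbb{R}^3$ ($I\subset\mathbb{R}$ an open interval) be a smooth curve with arc-length parameter $s$, curvature $\kappa$, torsion $\tau$ and Frenet frame $\{\vec T,\vec N,\vec B\}$, so $\vec T'=\kappa\vec N$, $\vec N'=-\kappa\vec T+\tau\vec B$, $\vec B'=-\tau\vec N$. Let $\theta:I\to\mathbb{R}$ be a $C^\infty$ function and $\vec q_o=\cos\theta\,\vec T+\sin\theta\,\vec N$. The osculating-type (OT)-ruled surface of $\alpha$ is $\vec\varphi_{(\alpha,q_o)}(s,u)=\vec\alpha(s)+u\,\vec q_o(s)$, $(s,u)\in I\times\mathbb{R}$. One writes $\varphi_{(\alpha,q_o)}=\varphi_{(\alpha,T)}$ (tangent surface) when $\theta(s)=k\pi$ for all $s\in I$ with some $k\in\mathbb{Z}$; in this case $\alpha$ is always assumed not to be a straight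 line, i.e. $\kappa\neq 0$. The surface "is a plane" means that its unit surface normal is constant, i.e. it is (part of) a plane. Put $\eta=\theta'+\kappa$, $\mu=\tau\sin\theta$, $\xi=\tau\cos\theta$, $f=\sin\theta-u\eta$, $g=u\mu$, $\vec r=\sin\theta\,\vec T-\cos\theta\,\vec N$; subscript $s$ denotes $\partial/\partial s$, and $g^2(f/g)_s$ stands for $gf_s-fg_s$. At regular points the unit normal is $\vec U=\frac{1}{\sqrt{f^2+g^2}}(f\vec B-g\vec r)$ and the Weingarten map $S_p(\vec v)=-D_{\vec v}\vec U$ satisfies $S_p(\partial_s\vec\varphi)=A_1\partial_s\vec\varphi+A_2\partial_u\vec\varphi$, $S_p(\partial_u\vec\varphi)=B_1\partial_s\vec\varphi+B_2\partial_u\vec\varphi$, where $$A_1=\frac{-1}{(f^2+g^2)^{3/2}}\left[g^2\left(\tfrac{f}{g}\right)_s+(f^2+g^2)\xi\right],$$ $$A_2=\frac{1}{(f^2+g^2)^{3/2}}\left[(f^2+g^2)(f\mu+g\eta+\xi\cos\theta)+g^2\cos\theta\left(\tfrac{f}{g}\right)_s\right],$$ $$B_1=\frac{\mu\sin\theta}{(f^2+g^2)^{3/2}},\qquad B_2=\frac{-\mu\cos\theta\sin\theta}{(f^2+g^2)^{3/2}}.$$ A curve on the surface is a line of curvature if its tangent vector is everywhere an eigenvector of $S_p$.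
   Formalization: In (ii), "B_1=0 implies plane or tangent surface" fails for smooth data; it is proved if τ or sin θ vanishes on all of I once it vanishes on a nonempty open subset, and in general on a dense family of subintervals. "Plane" means unit normal constant up to sign. *)

theory Defs
  imports "HOL-Analysis.Analysis"
begin

text \<open>\<open>D n\<close> is the \<open>n\<close>-th derivative; only the values of \<open>f\<close> on the open set \<open>I\<close> matter.\<close>

definition smooth_on :: "real set \<Rightarrow> (real \<Rightarrow> 'a::real_normed_vector) \<Rightarrow> bool" where
  "smooth_on I f \<longleftrightarrow>
     (\<exists>D. D 0 = f \<and> (\<forall>n. \<forall>s\<in>I. (D n has_vector_derivative D (Suc n) s) (at s)))"

text \<open>
  A smooth unit-speed curve with a smooth Frenet frame on an open interval. The curvature is
  allowed to vanish (as for a straight line), in which case the frame is not determined by the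
  curve and is part of the data. Where \<open>\<kappa> s > 0\<close>, these conditions force the usual formulas
  for \<open>N\<close>, \<open>\<kappa>\<close> and \<open>\<tau>\<close>.
\<close>

definition frenet_curve ::
  "real set \<Rightarrow> (real \<Rightarrow> real^3) \<Rightarrow> (real \<Rightarrow> real^3) \<Rightarrow> (real \<Rightarrow> real^3) \<Rightarrow> (real \<Rightarrow> real^3)
   \<Rightarrow> (real \<Rightarrow> real) \<Rightarrow> (real \<Rightarrow> real) \<Rightarrow> bool" where
  "frenet_curve I \<alpha> T N B \<kappa> \<tau> \<longleftrightarrow>
     open I \<and> is_interval I \<and> I \<noteq> {} \<and> smooth_on I \<alpha> \<and> smooth_on I N \<and>
     (\<forall>s\<in>I.
        norm (T s) = 1 \<and> norm (N s) = 1 \<and> T s \<bullet> N s = 0 \<and> B s = cross3 (T s) (N s) \<and> \<kappa> s \<ge> 0 \<and>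
        (\<alpha> has_vector_derivative T s) (at s) \<and>
        (T has_vector_derivative \<kappa> s *\<^sub>R N s) (at s) \<and>
        (N has_vector_derivative - \<kappa> s *\<^sub>R T s + \<tau> s *\<^sub>R B s) (at s) \<and>
        (B has_vector_derivative - \<tau> s *\<^sub>R N s) (at s))"

definition ot_ruled_surface ::
  "(real \<Rightarrow> real^3) \<Rightarrow> (real \<Rightarrow> real^3) \<Rightarrow> (real \<Rightarrow> real^3) \<Rightarrow> (real \<Rightarrow> real) \<Rightarrow> real \<times> real \<Rightarrow> real^3" where
  "ot_ruled_surface \<alpha> T N \<theta> =
     (\<lambda>(s, u). \<alpha> s + u *\<^sub>R (cos (\<theta> s) *\<^sub>R T s + sin (\<theta> s) *\<^sub>R N s))"

definition tangent_case :: "real set \<Rightarrow> (real \<Rightarrow> real) \<Rightarrow> bool" where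
  "tangent_case J \<theta> \<longleftrightarrow> (\<exists>k::int. \<forall>s\<in>J. \<theta> s = of_int k * pi)"

subsection \<open>Differential geometry of a parametrized surface\<close>

definition partial_s :: "(real \<times> real \<Rightarrow> real^3) \<Rightarrow> real \<times> real \<Rightarrow> real^3" where
  "partial_s X p = vector_derivative (\<lambda>s. X (s, snd p)) (at (fst p))"

definition partial_u :: "(real \<times> real \<Rightarrow> real^3) \<Rightarrow> real \<times> real \<Rightarrow> real^3" where
  "partial_u X p = vector_derivative (\<lambda>u. X (fst p, u)) (at (snd p))"

definition regular_at :: "(real \<times> real \<Rightarrow> real^3) \<Rightarrow> real \<times> real \<Rightarrow> bool" where
  "regular_at X p \<longleftrightarrow> cross3 (partial_s X p) (partial_u X p) \<noteq> 0"

definition unit_normal :: "(real \<times> real \<Rightarrow> real^3) \<Rightarrow> real \<times> real \<Rightarrow> real^3" where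
  "unit_normal X p = sgn (cross3 (partial_s X p) (partial_u X p))"

text \<open>
  The Weingarten map \<open>v \<mapsto> - D\<^sub>v U\<close> at the parameter point \<open>p\<close>: the tangent vector \<open>v\<close> is pulled
  back along the differential of \<open>X\<close>, which is injective at regular points. The value is
  meaningful only for \<open>v\<close> in the range of that differential.
\<close>

definition weingarten ::
  "(real \<times> real \<Rightarrow> real^3) \<Rightarrow> real \<times> real \<Rightarrow> real^3 \<Rightarrow> real^3" where
  "weingarten X p v =
     - frechet_derivative (unit_normal X) (at p) (THE w. frechet_derivative X (at p) w = v)"

text \<open>
  \<open>J\<close> is the set of \<open>s\<close>-values over which the surface is considered. The partial derivatives
  form a basis of the tangent plane at regular points, so the coefficients are uniquely
  determined there.
\<close>

definition weingarten_coeffs ::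
  "(real \<times> real \<Rightarrow> real^3) \<Rightarrow> real set \<Rightarrow> (real \<times> real \<Rightarrow> real) \<Rightarrow> (real \<times> real \<Rightarrow> real)
   \<Rightarrow> (real \<times> real \<Rightarrow> real) \<Rightarrow> (real \<times> real \<Rightarrow> real) \<Rightarrow> bool" where
  "weingarten_coeffs X J A1 A2 B1 B2 \<longleftrightarrow>
     (\<forall>p. fst p \<in> J \<and> regular_at X p \<longrightarrow>
        weingarten X p (partial_s X p) = A1 p *\<^sub>R partial_s X p + A2 p *\<^sub>R partial_u X p \<and>
        weingarten X p (partial_u X p) = B1 p *\<^sub>R partial_s X p + B2 p *\<^sub>R partial_u X p)"

text \<open>
  The curve is \<open>X \<circ> c\<close> with \<open>c\<close> a curve in the parameter domain. The Weingarten map exists only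
  at regular points of the surface, so the eigenvector condition is imposed there.
\<close>

definition line_of_curvature ::
  "(real \<times> real \<Rightarrow> real^3) \<Rightarrow> real set \<Rightarrow> (real \<Rightarrow> real \<times> real) \<Rightarrow> bool" where
  "line_of_curvature X J c \<longleftrightarrow>
     (\<forall>t\<in>J. regular_at X (c t) \<longrightarrow>
        (let v = vector_derivative (X \<circ> c) (at t)
         in v \<noteq> 0 \<and> (\<exists>l. weingarten X (c t) v = l *\<^sub>R v)))"

text \<open>
  Constancy of the unit normal is required up to sign: the normalized cross product of the
  partial derivatives may change sign across the singular locus, as it does already on the tangent
  surface of a planar circle.
\<close>

definition is_plane_over :: "real set \<Rightarrow> (real \<times> real \<Rightarrow> real^3) \<Rightarrow> bool" where
  "is_plane_over J X \<longleftrightarrow>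
     (\<exists>n. \<forall>p. fst p \<in> J \<and> regular_at X p \<longrightarrow> unit_normal X p = n \<or> unit_normal X p = - n)"

text \<open>
  Every real-analytic function has this property on an interval, and so does every function without
  zeros.
\<close>

definition locally_zero_imp_zero :: "real set \<Rightarrow> (real \<Rightarrow> real) \<Rightarrow> bool" where
  "locally_zero_imp_zero I h \<longleftrightarrow>
     (\<forall>K. open K \<and> K \<noteq> {} \<and> K \<subseteq> I \<and> (\<forall>s\<in>K. h s = 0) \<longrightarrow> (\<forall>s\<in>I. h s = 0))"

end

theory Submission
  imports Defs
begin

text \<open>
  Along \<open>\<alpha>\<close> the Frenet frame is rotated by \<open>\<theta>\<close> within the osculating plane, giving the
  orthonormal frame \<open>q, r, B\<close> adapted to the rulings. In it
  \<open>q' = - \<eta> r + \<mu> B\<close>, \<open>r' = \<eta> q - \<xi> B\<close>, \<open>B' = - \<mu> q + \<xi> r\<close>, the tangent vectors of the surface are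
  \<open>\<phi>\<^sub>s = cos \<theta> q + f r + g B\<close> and \<open>\<phi>\<^sub>u = q\<close>, and their cross product is \<open>W = f B - g r\<close>. A point is
  therefore regular exactly if \<open>f\<^sup>2 + g\<^sup>2 \<noteq> 0\<close>, and differentiating \<open>W / norm W\<close> gives the Weingarten
  coefficients, among them
  \<open>B1 = \<mu> sin \<theta> / (f\<^sup>2 + g\<^sup>2)\<^bsup>3/2\<^esup>\<close> (lemmas \<open>unit_normal_partials\<close>, \<open>A2_eq\<close>, \<open>B1_eq\<close>).

  Since \<open>\<phi>\<^sub>s\<close> and \<open>\<phi>\<^sub>u\<close> are independent, \<open>\<phi>\<^sub>s\<close> is an eigenvector of the Weingarten map iff \<open>A2 = 0\<close>
  and \<open>\<phi>\<^sub>u\<close> is one iff \<open>B1 = 0\<close>; this is the part about lines of curvature. At a singular point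
  \<open>f = g = 0\<close>, so the equation in (i) holds there automatically.

  For the geometric part of (ii), the vanishing of \<open>B1\<close> along a whole ruling is equivalent to
  \<open>\<mu> = \<tau> sin \<theta> = 0\<close>, because where \<open>sin \<theta> \<noteq> 0\<close> the point \<open>u = 0\<close> is regular. On an interval where
  \<open>\<tau> = 0\<close> the binormal is constant and is the normal of a plane; on an interval where
  \<open>sin \<theta> = 0\<close> the continuous function \<open>\<theta>\<close> takes values in the discrete set of multiples of \<open>pi\<close>, so
  it is constant. Conversely, tangent surfaces have \<open>sin \<theta> = 0\<close>, and in a plane the derivative
  of the unit normal vanishes. What remains is to pass from the pointwise alternative
  \<open>\<tau> s = 0 \<or> sin (\<theta> s) = 0\<close> to a uniform one. If one of the two functions vanishes identically as soon
  as it vanishes on some nonempty open set, the alternative is global: the set where the other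
  function is nonzero is open (lemma \<open>mu_zero_global\<close>). In general the alternative becomes uniform
  on a suitable subinterval of any nonempty open set, and continuity of \<open>\<mu>\<close> gives the converse
  (lemma \<open>mu_zero_dense\<close>).
\<close>

section \<open>Smooth functions on an open set\<close>

lemma smooth_on_has_vector_derivative:
  assumes "smooth_on I f"
  obtains f' where "\<And>s. s \<in> I \<Longrightarrow> (f has_vector_derivative f' s) (at s)"
  using assms unfolding smooth_on_def by metis

lemma smooth_on_cong:
  assumes "open I" "smooth_on I f" "\<And>s. s \<in> I \<Longrightarrow> f s = g s"
  shows "smooth_on I g"
proof -
  obtain D where D: "D 0 = f" "\<And>n s. s \<in> I \<Longrightarrow> (D n has_vector_derivative D (Suc n) s) (at s)"
    using assms(2) unfolding smooth_on_def by blast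
  have g': "(g has_vector_derivative D 1 s) (at s)" if "s \<in> I" for s
    using has_vector_derivative_transform_within_open[OF _ assms(1) that, of f "D 1 s" g]
      D(2)[OF that, of 0] D(1) assms(3) by simp
  show ?thesis
    unfolding smooth_on_def
    using D g' by (intro exI[of _ "\<lambda>n. if n = 0 then g else D n"]) auto
qed

text \<open>
  Smoothness of \<open>\<alpha>\<close>, \<open>N\<close> and \<open>\<theta>\<close> is inherited by \<open>T\<close>, by \<open>\<kappa> N\<close>, by \<open>N'\<close> and by \<open>\<theta>'\<close>. This is how the
  differentiability of \<open>\<kappa>\<close> and \<open>\<tau>\<close>, which are given only through the Frenet equations, is obtained.
\<close>

lemma smooth_on_vector_derivative:
  assumes "open I" "smooth_on I f" "\<And>s. s \<in> I \<Longrightarrow> (f has_vector_derivative f' s) (at s)"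
  shows "smooth_on I f'"
proof -
  obtain D where D: "D 0 = f" "\<And>n s. s \<in> I \<Longrightarrow> (D n has_vector_derivative D (Suc n) s) (at s)"
    using assms(2) unfolding smooth_on_def by blast
  have "smooth_on I (D 1)"
    unfolding smooth_on_def using D(2) by (intro exI[of _ "\<lambda>n. D (Suc n)"]) auto
  moreover have "D 1 s = f' s" if "s \<in> I" for s
    using vector_derivative_unique_at assms(3)[OF that] D(2)[OF that, of 0] D(1) by fastforce
  ultimately show ?thesis
    by (rule smooth_on_cong[OF assms(1)])
qed

lemma inner_differentiable_on_open:
  fixes a b :: "real \<Rightarrow> real^3"
  assumes "open I" "smooth_on I a" "smooth_on I b"
    and "\<And>s. s \<in> I \<Longrightarrow> a s \<bullet> b s = h s" and "s \<in> I"
  shows "h differentiable (at s)"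
proof -
  obtain a' where a': "(a has_vector_derivative a') (at s)"
    using smooth_on_has_vector_derivative[OF assms(2)] assms(5) by metis
  obtain b' where b': "(b has_vector_derivative b') (at s)"
    using smooth_on_has_vector_derivative[OF assms(3)] assms(5) by metis
  have "((\<lambda>s. a s \<bullet> b s) has_vector_derivative (a s \<bullet> b' + a' \<bullet> b s)) (at s)"
    by (rule bounded_bilinear.has_vector_derivative[OF bounded_bilinear_inner a' b'])
  then have "(h has_vector_derivative (a s \<bullet> b' + a' \<bullet> b s)) (at s)"
    by (rule has_vector_derivative_transform_within_open[OF _ assms(1) assms(5)]) (use assms(4) in auto)
  then show ?thesis
    by (rule differentiableI_vector)
qed

lemma nonzero_open:
  fixes h :: "real \<Rightarrow> real"
  assumes "open K" "continuous_on K h"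
  shows "open {s \<in> K. h s \<noteq> 0}"
  using continuous_open_preimage[OF assms(2,1), of "- {0}"]
  by (simp add: Int_def vimage_def open_Compl)

section \<open>Tangent planes and normalized vector fields\<close>

text \<open>
  Taking the cross product with \<open>y\<close> isolates the coefficient of \<open>x\<close>, and vice versa.
\<close>

lemma cross3_nonzero_coeffs_unique:
  assumes ne: "cross3 x y \<noteq> 0" and eq: "a *\<^sub>R x + b *\<^sub>R y = c *\<^sub>R x + d *\<^sub>R y"
  shows "a = c" "b = d"
proof -
  have "cross3 (a *\<^sub>R x + b *\<^sub>R y) y = cross3 (c *\<^sub>R x + d *\<^sub>R y) y"
    "cross3 x (a *\<^sub>R x + b *\<^sub>R y) = cross3 x (c *\<^sub>R x + d *\<^sub>R y)"
    using eq by simp_all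
  then show "a = c" "b = d"
    using ne by (simp_all add: cross_add_left cross_add_right cross_mult_left cross_mult_right)
qed

lemma eigenvector_iff:
  assumes ind: "cross3 x y \<noteq> 0"
  shows "x \<noteq> 0" "y \<noteq> 0"
    "(\<exists>l. a *\<^sub>R x + b *\<^sub>R y = l *\<^sub>R x) \<longleftrightarrow> b = 0"
    "(\<exists>l. a *\<^sub>R x + b *\<^sub>R y = l *\<^sub>R y) \<longleftrightarrow> a = 0"
proof -
  show "x \<noteq> 0" "y \<noteq> 0"
    using ind by auto
  show "(\<exists>l. a *\<^sub>R x + b *\<^sub>R y = l *\<^sub>R x) \<longleftrightarrow> b = 0"
    using cross3_nonzero_coeffs_unique(2)[OF ind, of a b _ 0] by auto
  show "(\<exists>l. a *\<^sub>R x + b *\<^sub>R y = l *\<^sub>R y) \<longleftrightarrow> a = 0"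
    using cross3_nonzero_coeffs_unique(1)[OF ind, of a b 0] by auto
qed

text \<open>
  Both the surface and its unnormalized normal field are affine in \<open>u\<close>, that is, of the form
  \<open>(s, u) \<mapsto> a s + u b s\<close>, so this lemma yields the total derivative of each of them from a curve
  derivative at fixed \<open>u\<close>.
\<close>

lemma ruled_map_has_derivative:
  fixes a b :: "real \<Rightarrow> 'a::real_normed_vector"
  assumes a: "((\<lambda>t. a t + u *\<^sub>R b t) has_vector_derivative d) (at s)"
    and b: "(b has_vector_derivative b') (at s)"
  shows "((\<lambda>p. a (fst p) + snd p *\<^sub>R b (fst p)) has_derivative
           (\<lambda>w. fst w *\<^sub>R d + snd w *\<^sub>R b s)) (at (s, u))"
proof -
  have A: "((\<lambda>p. a (fst p) + u *\<^sub>R b (fst p)) has_derivative (\<lambda>w. fst w *\<^sub>R d)) (at (s, u))"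
    using has_derivative_compose[OF has_derivative_fst[OF has_derivative_ident], of "\<lambda>t. a t + u *\<^sub>R b t" "\<lambda>h. h *\<^sub>R d" "(s,u)" UNIV]
      a unfolding has_vector_derivative_def by simp
  have B: "((\<lambda>p. b (fst p)) has_derivative (\<lambda>w. fst w *\<^sub>R b')) (at (s, u))"
    using has_derivative_compose[OF has_derivative_fst[OF has_derivative_ident], of b "\<lambda>h. h *\<^sub>R b'" "(s,u)" UNIV]
      b unfolding has_vector_derivative_def by simp
  have C: "((\<lambda>p::real \<times> real. snd p - u) has_derivative snd) (at (s, u))"
    by (auto intro!: derivative_eq_intros)
  \<comment> \<open>Split off the curve at the fixed parameter \<open>u\<close>; the remainder has the factor \<open>snd p - u\<close>, which
     is zero at the base point, so \<open>b'\<close> drops out.\<close>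
  have "((\<lambda>p. (a (fst p) + u *\<^sub>R b (fst p)) + (snd p - u) *\<^sub>R b (fst p)) has_derivative
         (\<lambda>w. fst w *\<^sub>R d + (((snd (s,u) - u) *\<^sub>R (fst w *\<^sub>R b')) + snd w *\<^sub>R b (fst (s, u))))) (at (s, u))"
    by (rule has_derivative_add[OF A has_derivative_scaleR[OF C B]])
  then show ?thesis
    by (simp add: algebra_simps)
qed

lemma sgn_has_derivative:
  fixes x :: "'a::real_inner"
  assumes "x \<noteq> 0"
  shows "(sgn has_derivative (\<lambda>h. (1 / norm x) *\<^sub>R h - ((x \<bullet> h) / norm x ^ 3) *\<^sub>R x)) (at x)"
proof -
  have N: "(norm has_derivative (\<lambda>h. h \<bullet> sgn x)) (at x)"
    by (rule has_derivative_norm[OF assms])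
  have I: "((\<lambda>y. inverse (norm y)) has_derivative
          (\<lambda>h. - (inverse (norm x) * (h \<bullet> sgn x) * inverse (norm x)))) (at x)"
    by (rule Deriv.has_derivative_inverse[OF _ N]) (use assms in simp)
  have "((\<lambda>y. inverse (norm y) *\<^sub>R y) has_derivative
         (\<lambda>h. inverse (norm x) *\<^sub>R h + (- (inverse (norm x) * (h \<bullet> sgn x) * inverse (norm x))) *\<^sub>R x)) (at x)"
    by (rule has_derivative_scaleR[OF I has_derivative_ident])
  then show ?thesis
    unfolding sgn_div_norm
    by (rule back_subst[of "\<lambda>D. (_ has_derivative D) _"])
       (auto simp: fun_eq_iff sgn_div_norm power3_eq_cube inner_commute divide_inverse algebra_simps)
qed

lemma cos_sin_scale:
  fixes v :: "'a::real_vector"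
  shows "(cos x * cos x) *\<^sub>R v = v - (sin x * sin x) *\<^sub>R v"
  by (metis (no_types) cos_squared_eq scaleR_left_diff_distrib scaleR_one power2_eq_square)

section \<open>The adapted frame of the surface\<close>

text \<open>
  The data of an OT-ruled surface together with its auxiliary functions, in the form in which they
  occur in the final theorem.
\<close>

locale ot_surface =
  fixes I :: "real set"
    and \<alpha> T N B :: "real \<Rightarrow> real^3"
    and \<kappa> \<tau> \<theta> \<eta> \<mu> \<xi> :: "real \<Rightarrow> real"
    and f g :: "real \<Rightarrow> real \<Rightarrow> real"
    and \<phi> :: "real \<times> real \<Rightarrow> real^3"
  assumes frenet: "frenet_curve I \<alpha> T N B \<kappa> \<tau>"
    and theta: "smooth_on I \<theta>"
    and phi: "\<phi> = ot_ruled_surface \<alpha> T N \<theta>"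
    and eta: "\<eta> = (\<lambda>s. deriv \<theta> s + \<kappa> s)"
    and mu: "\<mu> = (\<lambda>s. \<tau> s * sin (\<theta> s))"
    and xi: "\<xi> = (\<lambda>s. \<tau> s * cos (\<theta> s))"
    and f: "f = (\<lambda>s u. sin (\<theta> s) - u * \<eta> s)"
    and g: "g = (\<lambda>s u. u * \<mu> s)"
begin

definition q :: "real \<Rightarrow> real^3" where
  "q s = cos (\<theta> s) *\<^sub>R T s + sin (\<theta> s) *\<^sub>R N s"

definition r :: "real \<Rightarrow> real^3" where
  "r s = sin (\<theta> s) *\<^sub>R T s - cos (\<theta> s) *\<^sub>R N s"

text \<open>
  The cross product of the partial derivatives, before normalization (see \<open>cross_partials\<close>).
\<close>

definition normal_field :: "real \<times> real \<Rightarrow> real^3" where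
  "normal_field p = f (fst p) (snd p) *\<^sub>R B (fst p) - g (fst p) (snd p) *\<^sub>R r (fst p)"

lemma open_I: "open I" and interval_I: "is_interval I"
  and smooth_alpha: "smooth_on I \<alpha>" and smooth_N: "smooth_on I N"
  using frenet unfolding frenet_curve_def by auto

lemma frenet_equations:
  assumes "s \<in> I"
  shows "(\<alpha> has_vector_derivative T s) (at s)"
    "(T has_vector_derivative \<kappa> s *\<^sub>R N s) (at s)"
    "(N has_vector_derivative - \<kappa> s *\<^sub>R T s + \<tau> s *\<^sub>R B s) (at s)"
    "(B has_vector_derivative - \<tau> s *\<^sub>R N s) (at s)"
  using frenet assms unfolding frenet_curve_def by auto

lemma frenet_frame:
  assumes "s \<in> I"
  shows "T s \<bullet> T s = 1" "N s \<bullet> N s = 1" "T s \<bullet> N s = 0" "B s = cross3 (T s) (N s)"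
  using frenet assms unfolding frenet_curve_def by (auto simp: norm_eq_1)

lemma smooth_T: "smooth_on I T"
  using smooth_on_vector_derivative[OF open_I smooth_alpha] frenet_equations(1) .

lemma theta_deriv:
  assumes "s \<in> I"
  shows "(\<theta> has_real_derivative deriv \<theta> s) (at s)"
  using smooth_on_has_vector_derivative[OF theta] assms
  by (metis DERIV_imp_deriv has_real_derivative_iff_has_vector_derivative)

text \<open>
  The curvature is the inner product of the smooth maps \<open>\<kappa> N = T'\<close> and \<open>N\<close>.
\<close>

lemma eta_differentiable:
  assumes "s \<in> I"
  shows "(\<eta> has_real_derivative deriv \<eta> s) (at s)"
proof -
  have "smooth_on I (\<lambda>s. \<kappa> s *\<^sub>R N s)"
    using smooth_on_vector_derivative[OF open_I smooth_T] frenet_equations(2) .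
  then have "\<kappa> differentiable (at s)"
    by (rule inner_differentiable_on_open[OF open_I _ smooth_N _ assms])
       (use frenet_frame in auto)
  moreover have "smooth_on I (deriv \<theta>)"
    using smooth_on_vector_derivative[OF open_I theta] theta_deriv
    by (simp add: has_real_derivative_iff_has_vector_derivative)
  then have "deriv \<theta> differentiable (at s)"
    using smooth_on_has_vector_derivative assms differentiableI_vector by metis
  ultimately show ?thesis
    unfolding eta by (simp add: DERIV_deriv_iff_real_differentiable)
qed

text \<open>
  The torsion is the \<open>B\<close>-component of \<open>N'\<close>, and \<open>N'\<close> is smooth.
\<close>

lemma torsion_differentiable:
  assumes "s \<in> I"
  shows "\<tau> differentiable (at s)"
proof -
  have N': "smooth_on I (\<lambda>s. - \<kappa> s *\<^sub>R T s + \<tau> s *\<^sub>R B s)"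
    using smooth_on_vector_derivative[OF open_I smooth_N] frenet_equations(3) .
  obtain N2 where N2: "((\<lambda>s. - \<kappa> s *\<^sub>R T s + \<tau> s *\<^sub>R B s) has_vector_derivative N2) (at s)"
    using smooth_on_has_vector_derivative[OF N'] assms by metis
  have "((\<lambda>s. (- \<kappa> s *\<^sub>R T s + \<tau> s *\<^sub>R B s) \<bullet> B s) has_vector_derivative
      ((- \<kappa> s *\<^sub>R T s + \<tau> s *\<^sub>R B s) \<bullet> (- \<tau> s *\<^sub>R N s) + N2 \<bullet> B s)) (at s)"
    by (rule bounded_bilinear.has_vector_derivative[OF bounded_bilinear_inner N2 frenet_equations(4)[OF assms]])
  moreover have "(- \<kappa> t *\<^sub>R T t + \<tau> t *\<^sub>R B t) \<bullet> B t = \<tau> t" if "t \<in> I" for t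
    using frenet_frame[OF that] inner_commute[of "N t" "T t"]
    by (simp add: inner_diff_left dot_cross_self dot_cross)
  ultimately have "(\<tau> has_vector_derivative
      ((- \<kappa> s *\<^sub>R T s + \<tau> s *\<^sub>R B s) \<bullet> (- \<tau> s *\<^sub>R N s) + N2 \<bullet> B s)) (at s)"
    using has_vector_derivative_transform_within_open[OF _ open_I assms] by blast
  then show ?thesis
    by (rule differentiableI_vector)
qed

lemma mu_differentiable:
  assumes "s \<in> I"
  shows "(\<mu> has_real_derivative deriv \<mu> s) (at s)"
proof -
  have t: "(\<tau> has_real_derivative deriv \<tau> s) (at s)"
    using torsion_differentiable[OF assms] by (simp add: DERIV_deriv_iff_real_differentiable)
  have "(\<mu> has_real_derivative (deriv \<tau> s * sin (\<theta> s) + \<tau> s * (cos (\<theta> s) * deriv \<theta> s))) (at s)"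
    unfolding mu by (auto intro!: derivative_eq_intros t theta_deriv assms)
  then show ?thesis
    by (metis DERIV_imp_deriv)
qed

lemma f_deriv:
  assumes "s \<in> I"
  shows "((\<lambda>t. f t u) has_real_derivative deriv (\<lambda>t. f t u) s) (at s)"
proof -
  have "((\<lambda>t. f t u) has_real_derivative (cos (\<theta> s) * deriv \<theta> s - u * deriv \<eta> s)) (at s)"
    unfolding f by (auto intro!: derivative_eq_intros eta_differentiable theta_deriv assms)
  then show ?thesis
    by (metis DERIV_imp_deriv)
qed

lemma g_deriv:
  assumes "s \<in> I"
  shows "((\<lambda>t. g t u) has_real_derivative deriv (\<lambda>t. g t u) s) (at s)"
proof -
  have "((\<lambda>t. g t u) has_real_derivative (u * deriv \<mu> s)) (at s)"
    unfolding g by (auto intro!: derivative_eq_intros mu_differentiable assms)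
  then show ?thesis
    by (metis DERIV_imp_deriv)
qed

lemma f_apply: "f s u = sin (\<theta> s) - u * \<eta> s" and g_apply: "g s u = u * \<mu> s"
  by (simp_all add: f g)

lemma frenet_in_adapted_frame:
  "T s = cos (\<theta> s) *\<^sub>R q s + sin (\<theta> s) *\<^sub>R r s"
  "N s = sin (\<theta> s) *\<^sub>R q s - cos (\<theta> s) *\<^sub>R r s"
  by (simp_all add: q_def r_def algebra_simps cos_sin_scale)

lemma adapted_frame:
  assumes "s \<in> I"
  shows "q s \<bullet> q s = 1" "r s \<bullet> r s = 1" "B s \<bullet> B s = 1"
    "q s \<bullet> r s = 0" "r s \<bullet> B s = 0" "q s \<bullet> B s = 0"
    "cross3 (r s) (q s) = B s" "cross3 (B s) (q s) = - r s"
proof -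
  note F = frenet_frame[OF assms]
  have F': "N s \<bullet> T s = 0" using F(3) by (simp add: inner_commute)
  show "q s \<bullet> q s = 1" "r s \<bullet> r s = 1" "q s \<bullet> r s = 0"
    unfolding q_def r_def
    using F F' sin_cos_squared_add[of "\<theta> s"]
    by (simp_all add: inner_add_left inner_add_right inner_diff_left inner_diff_right
          power2_eq_square algebra_simps)
  show "B s \<bullet> B s = 1"
    using F by (simp add: dot_cross inner_commute)
  show "r s \<bullet> B s = 0" "q s \<bullet> B s = 0"
    unfolding q_def r_def F(4)
    by (simp_all add: inner_add_left inner_diff_left dot_cross_self)
  have skew: "cross3 (N s) (T s) = - B s"
    using cross_skew F(4) by metis
  have BT: "cross3 (B s) (T s) = N s" "cross3 (B s) (N s) = - T s"
    unfolding F(4) using F F' cross_skew[of "cross3 (T s) (N s)"]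
    by (simp_all add: Lagrange)
  show "cross3 (r s) (q s) = B s"
    unfolding q_def r_def
    by (simp add: cross_add_left cross_add_right cross_mult_left cross_mult_right
        Cross3.left_diff_distrib F(4)[symmetric] skew algebra_simps cos_sin_scale)
  show "cross3 (B s) (q s) = - r s"
    unfolding q_def r_def
    by (simp add: cross_add_right cross_mult_right BT)
qed

text \<open>
  The structure equations of the adapted frame: the rotation by \<open>\<theta>\<close> changes the curvature \<open>\<kappa>\<close> into
  \<open>\<eta> = \<theta>' + \<kappa>\<close> and splits the torsion into its components \<open>\<mu>\<close> and \<open>\<xi>\<close>.
\<close>

lemma adapted_frame_equations:
  assumes "s \<in> I"
  shows "(q has_vector_derivative (\<mu> s *\<^sub>R B s - \<eta> s *\<^sub>R r s)) (at s)"
    "(r has_vector_derivative (\<eta> s *\<^sub>R q s - \<xi> s *\<^sub>R B s)) (at s)"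
    "(B has_vector_derivative (\<xi> s *\<^sub>R r s - \<mu> s *\<^sub>R q s)) (at s)"
proof -
  note d = frenet_equations[OF assms]
  have s: "((\<lambda>t. sin (\<theta> t)) has_real_derivative cos (\<theta> s) * deriv \<theta> s) (at s)"
    by (auto intro!: derivative_eq_intros theta_deriv assms)
  have c: "((\<lambda>t. cos (\<theta> t)) has_real_derivative - sin (\<theta> s) * deriv \<theta> s) (at s)"
    by (auto intro!: derivative_eq_intros theta_deriv assms)
  have "(q has_vector_derivative
      ((cos (\<theta> s) *\<^sub>R (\<kappa> s *\<^sub>R N s) + (- sin (\<theta> s) * deriv \<theta> s) *\<^sub>R T s) +
       (sin (\<theta> s) *\<^sub>R (- \<kappa> s *\<^sub>R T s + \<tau> s *\<^sub>R B s) + (cos (\<theta> s) * deriv \<theta> s) *\<^sub>R N s))) (at s)"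
    unfolding q_def
    by (intro has_vector_derivative_add has_vector_derivative_scaleR s c d)
  then show "(q has_vector_derivative (\<mu> s *\<^sub>R B s - \<eta> s *\<^sub>R r s)) (at s)"
    by (rule back_subst[of "\<lambda>v. (q has_vector_derivative v) _"])
       (simp add: r_def mu eta algebra_simps)
  have "(r has_vector_derivative
      ((sin (\<theta> s) *\<^sub>R (\<kappa> s *\<^sub>R N s) + (cos (\<theta> s) * deriv \<theta> s) *\<^sub>R T s) -
       (cos (\<theta> s) *\<^sub>R (- \<kappa> s *\<^sub>R T s + \<tau> s *\<^sub>R B s) + (- sin (\<theta> s) * deriv \<theta> s) *\<^sub>R N s))) (at s)"
    unfolding r_def
    by (intro has_vector_derivative_diff has_vector_derivative_scaleR s c d)
  then show "(r has_vector_derivative (\<eta> s *\<^sub>R q s - \<xi> s *\<^sub>R B s)) (at s)"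
    by (rule back_subst[of "\<lambda>v. (r has_vector_derivative v) _"])
       (simp add: q_def xi eta algebra_simps)
  show "(B has_vector_derivative (\<xi> s *\<^sub>R r s - \<mu> s *\<^sub>R q s)) (at s)"
    using d(4) by (rule back_subst[of "\<lambda>v. (B has_vector_derivative v) _"])
       (simp add: frenet_in_adapted_frame xi mu algebra_simps)
qed

section \<open>The Weingarten map of the surface\<close>

text \<open>
  The partial derivative of the surface with respect to \<open>s\<close>, in the adapted frame.
\<close>

definition tangent_s :: "real \<Rightarrow> real \<Rightarrow> real^3" where
  "tangent_s s u = cos (\<theta> s) *\<^sub>R q s + f s u *\<^sub>R r s + g s u *\<^sub>R B s"

lemma phi_ruled: "\<phi> = (\<lambda>p. \<alpha> (fst p) + snd p *\<^sub>R q (fst p))"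
  by (auto simp: phi ot_ruled_surface_def q_def)

lemma phi_curve_s:
  assumes "s \<in> I"
  shows "((\<lambda>t. \<phi> (t, u)) has_vector_derivative tangent_s s u) (at s)"
proof -
  have "((\<lambda>t. \<alpha> t + u *\<^sub>R q t) has_vector_derivative
      (T s + u *\<^sub>R (\<mu> s *\<^sub>R B s - \<eta> s *\<^sub>R r s))) (at s)"
    by (auto intro!: derivative_eq_intros frenet_equations adapted_frame_equations assms)
  moreover have "T s + u *\<^sub>R (\<mu> s *\<^sub>R B s - \<eta> s *\<^sub>R r s) = tangent_s s u"
    by (subst frenet_in_adapted_frame) (simp add: tangent_s_def f_apply g_apply algebra_simps)
  ultimately show ?thesis
    by (simp add: phi_ruled)
qed

lemma phi_curve_u: "((\<lambda>u. \<phi> (s, u)) has_vector_derivative q s) (at u)"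
  unfolding phi_ruled by (auto intro!: derivative_eq_intros)

lemma partial_s_phi: "s \<in> I \<Longrightarrow> partial_s \<phi> (s, u) = tangent_s s u"
  unfolding partial_s_def using phi_curve_s by (simp add: vector_derivative_at)

lemma partial_u_phi: "partial_u \<phi> (s, u) = q s"
  unfolding partial_u_def using phi_curve_u by (simp add: vector_derivative_at)

lemma cross_partials:
  assumes "s \<in> I"
  shows "cross3 (tangent_s s u) (q s) = normal_field (s, u)"
  using adapted_frame[OF assms]
  by (simp add: tangent_s_def normal_field_def cross_add_left cross_mult_left)

lemma norm_normal_field:
  assumes "s \<in> I"
  shows "norm (normal_field (s, u)) = sqrt ((f s u)\<^sup>2 + (g s u)\<^sup>2)"
  using adapted_frame[OF assms]
  by (simp add: norm_eq_sqrt_inner normal_field_def inner_diff_left inner_diff_right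
      inner_commute power2_eq_square)

lemma regular_iff_normal_field: "fst p \<in> I \<Longrightarrow> regular_at \<phi> p \<longleftrightarrow> normal_field p \<noteq> 0"
  by (cases p) (simp add: regular_at_def partial_s_phi partial_u_phi cross_partials)

lemma regular_iff:
  assumes "s \<in> I"
  shows "regular_at \<phi> (s, u) \<longleftrightarrow> (f s u)\<^sup>2 + (g s u)\<^sup>2 \<noteq> 0"
proof -
  have "regular_at \<phi> (s, u) \<longleftrightarrow> norm (normal_field (s, u)) \<noteq> 0"
    by (simp add: regular_iff_normal_field assms)
  then show ?thesis
    by (simp add: norm_normal_field assms)
qed

lemma unit_normal_phi: "fst p \<in> I \<Longrightarrow> unit_normal \<phi> p = sgn (normal_field p)"
  by (cases p) (simp add: unit_normal_def partial_s_phi partial_u_phi cross_partials)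

lemma phi_has_derivative:
  assumes "s \<in> I"
  shows "(\<phi> has_derivative (\<lambda>w. fst w *\<^sub>R tangent_s s u + snd w *\<^sub>R q s)) (at (s, u))"
  using ruled_map_has_derivative[of \<alpha> u q "tangent_s s u" s] phi_curve_s[OF assms, of u]
    adapted_frame_equations(1)[OF assms]
  by (simp add: phi_ruled)

text \<open>
  The partial derivatives of \<open>normal_field\<close>; the first is grouped as the product rule and the
  structure equations produce it.
\<close>

definition normal_s :: "real \<Rightarrow> real \<Rightarrow> real^3" where
  "normal_s s u =
     (f s u *\<^sub>R (\<xi> s *\<^sub>R r s - \<mu> s *\<^sub>R q s) + deriv (\<lambda>t. f t u) s *\<^sub>R B s) -
     (g s u *\<^sub>R (\<eta> s *\<^sub>R q s - \<xi> s *\<^sub>R B s) + deriv (\<lambda>t. g t u) s *\<^sub>R r s)"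

definition normal_u :: "real \<Rightarrow> real^3" where
  "normal_u s = - \<eta> s *\<^sub>R B s - \<mu> s *\<^sub>R r s"

lemma normal_field_ruled:
  "normal_field = (\<lambda>p. sin (\<theta> (fst p)) *\<^sub>R B (fst p) + snd p *\<^sub>R normal_u (fst p))"
  by (auto simp: normal_field_def normal_u_def f_apply g_apply algebra_simps)

lemma normal_field_has_derivative:
  assumes "s \<in> I"
  shows "(normal_field has_derivative (\<lambda>w. fst w *\<^sub>R normal_s s u + snd w *\<^sub>R normal_u s)) (at (s, u))"
proof -
  have "((\<lambda>t. normal_field (t, u)) has_vector_derivative normal_s s u) (at s)"
    unfolding normal_field_def normal_s_def fst_conv snd_conv
    by (intro has_vector_derivative_diff has_vector_derivative_scaleR f_deriv g_deriv
        adapted_frame_equations assms)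
  then have s: "((\<lambda>t. sin (\<theta> t) *\<^sub>R B t + u *\<^sub>R normal_u t) has_vector_derivative normal_s s u) (at s)"
    by (simp add: normal_field_ruled)
  have "normal_u differentiable (at s)"
    unfolding normal_u_def
    using eta_differentiable[OF assms] mu_differentiable[OF assms] adapted_frame_equations[OF assms]
    by (intro differentiable_diff differentiable_scaleR differentiable_minus)
       (auto simp: DERIV_deriv_iff_real_differentiable intro: differentiableI_vector)
  then obtain d where "(normal_u has_vector_derivative d) (at s)"
    by (metis vector_derivative_works)
  from ruled_map_has_derivative[OF s this] show ?thesis
    by (simp add: normal_field_ruled)
qed

lemma unit_normal_has_derivative:
  assumes s: "s \<in> I" and reg: "regular_at \<phi> (s, u)"
  defines "W \<equiv> normal_field (s, u)"
  shows "(unit_normal \<phi> has_derivative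
           (\<lambda>w. (1 / norm W) *\<^sub>R (fst w *\<^sub>R normal_s s u + snd w *\<^sub>R normal_u s) -
                ((W \<bullet> (fst w *\<^sub>R normal_s s u + snd w *\<^sub>R normal_u s)) / norm W ^ 3) *\<^sub>R W)) (at (s, u))"
proof -
  have "W \<noteq> 0"
    using reg unfolding W_def by (simp add: regular_iff_normal_field s)
  then have "((\<lambda>p. sgn (normal_field p)) has_derivative
           (\<lambda>w. (1 / norm W) *\<^sub>R (fst w *\<^sub>R normal_s s u + snd w *\<^sub>R normal_u s) -
                ((W \<bullet> (fst w *\<^sub>R normal_s s u + snd w *\<^sub>R normal_u s)) / norm W ^ 3) *\<^sub>R W)) (at (s, u))"
    unfolding W_def
    by (rule has_derivative_compose[OF normal_field_has_derivative[OF s] sgn_has_derivative])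
  then show ?thesis
    by (rule has_derivative_transform_within_open[of _ _ _ _ "I \<times> UNIV"])
       (use s open_I in \<open>auto simp: open_Times unit_normal_phi\<close>)
qed

lemma tangents_independent:
  assumes "s \<in> I" "regular_at \<phi> (s, u)"
  shows "cross3 (tangent_s s u) (q s) \<noteq> 0"
  using assms by (simp add: regular_at_def partial_s_phi partial_u_phi)

text \<open>
  At a regular point the differential of \<open>\<phi>\<close> is injective, so that the pullback of a tangent vector is
  the pair of its coordinates.
\<close>

lemma weingarten_phi:
  assumes s: "s \<in> I" and reg: "regular_at \<phi> (s, u)"
  shows "weingarten \<phi> (s, u) (a *\<^sub>R tangent_s s u + b *\<^sub>R q s) =
    - frechet_derivative (unit_normal \<phi>) (at (s, u)) (a, b)"
proof -
  have D: "frechet_derivative \<phi> (at (s, u)) = (\<lambda>w. fst w *\<^sub>R tangent_s s u + snd w *\<^sub>R q s)"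
    using frechet_derivative_at[OF phi_has_derivative[OF s]] by simp
  note ne = tangents_independent[OF s reg]
  have "(THE w. frechet_derivative \<phi> (at (s, u)) w = a *\<^sub>R tangent_s s u + b *\<^sub>R q s) = (a, b)"
    by (rule the_equality)
       (use cross3_nonzero_coeffs_unique[OF ne] in \<open>auto simp: D prod_eq_iff\<close>)
  then show ?thesis
    by (simp add: weingarten_def)
qed

text \<open>
  The terms containing \<open>u\<close> cancel. This is why the numerator of \<open>B1\<close> depends only on the ruling and
  not on the position along it.
\<close>

lemma ruling_coeff: "f s u * \<mu> s + g s u * \<eta> s = \<mu> s * sin (\<theta> s)"
  by (simp add: f_apply g_apply algebra_simps)

text \<open>
  The Weingarten equations. With \<open>W = f B - g r\<close> and \<open>n = norm W\<close>, the derivative of \<open>W / n\<close> is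
  \<open>W' / n - (W \<bullet> W') W / n\<^sup>3\<close>. It is orthogonal to \<open>W\<close>, hence its components along \<open>r\<close> and \<open>B\<close> are
  proportional to \<open>f\<close> and \<open>g\<close>; so it is a combination of \<open>q\<close> and
  \<open>f r + g B = \<phi>\<^sub>s - cos \<theta> \<phi>\<^sub>u\<close>.
\<close>

lemma unit_normal_partials:
  assumes s: "s \<in> I" and reg: "regular_at \<phi> (s, u)"
    and n_def: "n = sqrt ((f s u)\<^sup>2 + (g s u)\<^sup>2)"
    and P_def: "P = n\<^sup>2 * \<xi> s + g s u * deriv (\<lambda>t. f t u) s - f s u * deriv (\<lambda>t. g t u) s"
  shows "frechet_derivative (unit_normal \<phi>) (at (s, u)) (1, 0) =
      (P / n ^ 3) *\<^sub>R tangent_s s u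
       + (- ((f s u * \<mu> s + g s u * \<eta> s) / n + cos (\<theta> s) * P / n ^ 3)) *\<^sub>R q s"
    and "frechet_derivative (unit_normal \<phi>) (at (s, u)) (0, 1) =
      (- (\<mu> s * sin (\<theta> s) / n ^ 3)) *\<^sub>R tangent_s s u
       + (\<mu> s * cos (\<theta> s) * sin (\<theta> s) / n ^ 3) *\<^sub>R q s"
proof -
  define F where "F = f s u"
  define G where "G = g s u"
  define Fs where "Fs = deriv (\<lambda>t. f t u) s"
  define Gs where "Gs = deriv (\<lambda>t. g t u) s"
  note fold = F_def[symmetric] G_def[symmetric] Fs_def[symmetric] Gs_def[symmetric]
  have n2: "n * n = F * F + G * G"
    unfolding n_def fold by (simp add: power2_eq_square)
  have n0: "n \<noteq> 0"
    using reg regular_iff[OF s] unfolding n_def by simp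
  note D = frechet_derivative_at[OF unit_normal_has_derivative[OF s reg], symmetric]
  note A = adapted_frame[OF s]
  have A': "r s \<bullet> q s = 0" "B s \<bullet> r s = 0" "B s \<bullet> q s = 0"
    using A by (simp_all add: inner_commute)
  have W: "normal_field (s, u) = F *\<^sub>R B s - G *\<^sub>R r s"
    by (simp add: normal_field_def fold)
  have W1: "normal_field (s, u) \<bullet> normal_s s u = F * Fs + G * Gs"
    unfolding W normal_s_def fold
    by (simp add: inner_diff_left inner_diff_right inner_add_right A A' algebra_simps)
  have W2: "normal_field (s, u) \<bullet> normal_u s = G * \<mu> s - F * \<eta> s"
    unfolding W normal_u_def
    by (simp add: inner_diff_left inner_diff_right inner_add_right A A' algebra_simps)
  have N: "norm (normal_field (s, u)) = n"
    unfolding n_def by (rule norm_normal_field[OF s])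
  \<comment> \<open>Brings all terms to the denominator \<open>n ^ 3\<close>, where the cancellations become polynomial identities.\<close>
  have inv_n: "1 / n = (F * F + G * G) / n ^ 3"
    using n0 by (simp add: n2[symmetric] power3_eq_cube)
  have "frechet_derivative (unit_normal \<phi>) (at (s, u)) (1, 0) =
      (1 / n) *\<^sub>R normal_s s u - ((F * Fs + G * Gs) / n ^ 3) *\<^sub>R (F *\<^sub>R B s - G *\<^sub>R r s)"
    unfolding D by (simp add: N W1 W2, simp add: W)
  also have "\<dots> = (- (F * \<mu> s + G * \<eta> s) / n) *\<^sub>R q s
      + (F * \<xi> s / n - Gs / n + G * (F * Fs + G * Gs) / n ^ 3) *\<^sub>R r s
      + (G * \<xi> s / n + Fs / n - F * (F * Fs + G * Gs) / n ^ 3) *\<^sub>R B s"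
    unfolding normal_s_def fold by (simp add: algebra_simps add_divide_distrib diff_divide_distrib)
  also have "F * \<xi> s / n - Gs / n + G * (F * Fs + G * Gs) / n ^ 3 = (P / n ^ 3) * F"
    using n0 unfolding P_def fold power2_eq_square n2
    by (simp add: divide_inverse inv_n[unfolded divide_inverse, simplified] algebra_simps)
  also have "G * \<xi> s / n + Fs / n - F * (F * Fs + G * Gs) / n ^ 3 = (P / n ^ 3) * G"
    using n0 unfolding P_def fold power2_eq_square n2
    by (simp add: divide_inverse inv_n[unfolded divide_inverse, simplified] algebra_simps)
  finally show "frechet_derivative (unit_normal \<phi>) (at (s, u)) (1, 0) =
      (P / n ^ 3) *\<^sub>R tangent_s s u
       + (- ((f s u * \<mu> s + g s u * \<eta> s) / n + cos (\<theta> s) * P / n ^ 3)) *\<^sub>R q s"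
    unfolding tangent_s_def fold by (simp add: algebra_simps add_divide_distrib diff_divide_distrib)
  have "frechet_derivative (unit_normal \<phi>) (at (s, u)) (0, 1) =
      (1 / n) *\<^sub>R normal_u s - ((G * \<mu> s - F * \<eta> s) / n ^ 3) *\<^sub>R (F *\<^sub>R B s - G *\<^sub>R r s)"
    unfolding D by (simp add: N W1 W2, simp add: W)
  also have "\<dots> = (- \<mu> s / n + G * (G * \<mu> s - F * \<eta> s) / n ^ 3) *\<^sub>R r s
      + (- \<eta> s / n - F * (G * \<mu> s - F * \<eta> s) / n ^ 3) *\<^sub>R B s"
    unfolding normal_u_def by (simp add: algebra_simps add_divide_distrib diff_divide_distrib)
  also have "- \<mu> s / n + G * (G * \<mu> s - F * \<eta> s) / n ^ 3 = - (F * \<mu> s + G * \<eta> s) / n ^ 3 * F"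
    by (simp add: divide_inverse inv_n[unfolded divide_inverse, simplified] algebra_simps)
  also have "- \<eta> s / n - F * (G * \<mu> s - F * \<eta> s) / n ^ 3 = - (F * \<mu> s + G * \<eta> s) / n ^ 3 * G"
    by (simp add: divide_inverse inv_n[unfolded divide_inverse, simplified] algebra_simps)
  finally show "frechet_derivative (unit_normal \<phi>) (at (s, u)) (0, 1) =
      (- (\<mu> s * sin (\<theta> s) / n ^ 3)) *\<^sub>R tangent_s s u
       + (\<mu> s * cos (\<theta> s) * sin (\<theta> s) / n ^ 3) *\<^sub>R q s"
    unfolding ruling_coeff[of s u, unfolded fold] tangent_s_def fold
    by (simp add: algebra_simps add_divide_distrib diff_divide_distrib)
qed

section \<open>Lines of curvature\<close>

context
  fixes A1 A2 B1 B2 :: "real \<times> real \<Rightarrow> real"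
  assumes coeffs: "weingarten_coeffs \<phi> I A1 A2 B1 B2"
begin

lemma weingarten_tangents:
  assumes "s \<in> I" "regular_at \<phi> (s, u)"
  shows "weingarten \<phi> (s, u) (tangent_s s u) = A1 (s, u) *\<^sub>R tangent_s s u + A2 (s, u) *\<^sub>R q s"
    "weingarten \<phi> (s, u) (q s) = B1 (s, u) *\<^sub>R tangent_s s u + B2 (s, u) *\<^sub>R q s"
  using coeffs assms unfolding weingarten_coeffs_def
  by (metis fst_conv partial_s_phi partial_u_phi)+

lemma A2_eq:
  assumes s: "s \<in> I" and reg: "regular_at \<phi> (s, u)"
  shows "A2 (s, u) = (((f s u)\<^sup>2 + (g s u)\<^sup>2) * (f s u * \<mu> s + g s u * \<eta> s + \<xi> s * cos (\<theta> s))
                 + cos (\<theta> s) * (g s u * deriv (\<lambda>t. f t u) s - f s u * deriv (\<lambda>t. g t u) s)) /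
              sqrt ((f s u)\<^sup>2 + (g s u)\<^sup>2) ^ 3"
proof -
  define n where "n = sqrt ((f s u)\<^sup>2 + (g s u)\<^sup>2)"
  define P where "P = n\<^sup>2 * \<xi> s + g s u * deriv (\<lambda>t. f t u) s - f s u * deriv (\<lambda>t. g t u) s"
  have n2: "(f s u)\<^sup>2 + (g s u)\<^sup>2 = n\<^sup>2"
    by (simp add: n_def)
  have n0: "n \<noteq> 0"
    using reg regular_iff[OF s] by (simp add: n_def)
  have "A1 (s, u) *\<^sub>R tangent_s s u + A2 (s, u) *\<^sub>R q s =
      (- (P / n ^ 3)) *\<^sub>R tangent_s s u
      + ((f s u * \<mu> s + g s u * \<eta> s) / n + cos (\<theta> s) * P / n ^ 3) *\<^sub>R q s"
    using weingarten_phi[OF s reg, of 1 0] unit_normal_partials(1)[OF s reg n_def P_def]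
      weingarten_tangents(1)[OF s reg]
    by (simp add: algebra_simps)
  from cross3_nonzero_coeffs_unique(2)[OF tangents_independent[OF s reg] this]
  have "A2 (s, u) = (f s u * \<mu> s + g s u * \<eta> s) / n + cos (\<theta> s) * P / n ^ 3" .
  also have "\<dots> = (n\<^sup>2 * (f s u * \<mu> s + g s u * \<eta> s + \<xi> s * cos (\<theta> s))
                 + cos (\<theta> s) * (g s u * deriv (\<lambda>t. f t u) s - f s u * deriv (\<lambda>t. g t u) s)) / n ^ 3"
    using n0 unfolding P_def by (simp add: field_simps power2_eq_square power3_eq_cube)
  finally show ?thesis
    unfolding n_def[symmetric] unfolding n2 .
qed

lemma B1_eq:
  assumes s: "s \<in> I" and reg: "regular_at \<phi> (s, u)"
  shows "B1 (s, u) = \<mu> s * sin (\<theta> s) / sqrt ((f s u)\<^sup>2 + (g s u)\<^sup>2) ^ 3"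
proof -
  define n where "n = sqrt ((f s u)\<^sup>2 + (g s u)\<^sup>2)"
  have "B1 (s, u) *\<^sub>R tangent_s s u + B2 (s, u) *\<^sub>R q s =
      (\<mu> s * sin (\<theta> s) / n ^ 3) *\<^sub>R tangent_s s u
      + (- (\<mu> s * cos (\<theta> s) * sin (\<theta> s) / n ^ 3)) *\<^sub>R q s"
    using weingarten_phi[OF s reg, of 0 1] unit_normal_partials(2)[OF s reg n_def refl]
      weingarten_tangents(2)[OF s reg]
    by (simp add: algebra_simps)
  from cross3_nonzero_coeffs_unique(1)[OF tangents_independent[OF s reg] this] show ?thesis
    unfolding n_def .
qed

text \<open>
  Singular points cause no discrepancy: there \<open>f = g = 0\<close>, and both summands on the right contain a
  factor \<open>f\<close> or \<open>g\<close> in every term.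
\<close>

lemma A2_zero_iff:
  assumes s: "s \<in> I"
  shows "(regular_at \<phi> (s, u) \<longrightarrow> A2 (s, u) = 0) \<longleftrightarrow>
    ((f s u)\<^sup>2 + (g s u)\<^sup>2) * (f s u * \<mu> s + g s u * \<eta> s + \<xi> s * cos (\<theta> s))
      + cos (\<theta> s) * (g s u * deriv (\<lambda>t. f t u) s - f s u * deriv (\<lambda>t. g t u) s) = 0"
proof (cases "regular_at \<phi> (s, u)")
  case True
  have "sqrt ((f s u)\<^sup>2 + (g s u)\<^sup>2) ^ 3 \<noteq> 0"
    using True regular_iff[OF s] by (metis power_not_zero real_sqrt_eq_zero_cancel_iff)
  then show ?thesis
    using True unfolding A2_eq[OF s True] by (simp only: divide_eq_0_iff simp_thms)
next
  case False
  then have "f s u = 0" "g s u = 0"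
    using regular_iff[OF s] by (simp_all add: sum_power2_eq_zero_iff)
  with False show ?thesis
    by simp
qed

lemma base_curve_line_of_curvature_iff:
  "line_of_curvature \<phi> I (\<lambda>s. (s, u)) \<longleftrightarrow> (\<forall>s\<in>I. regular_at \<phi> (s, u) \<longrightarrow> A2 (s, u) = 0)"
proof -
  have v: "vector_derivative (\<phi> \<circ> (\<lambda>s. (s, u))) (at s) = tangent_s s u" if "s \<in> I" for s
    using phi_curve_s[OF that] by (simp add: o_def vector_derivative_at)
  have "tangent_s s u \<noteq> 0 \<and> (\<exists>l. weingarten \<phi> (s, u) (tangent_s s u) = l *\<^sub>R tangent_s s u)
      \<longleftrightarrow> A2 (s, u) = 0" if "s \<in> I" "regular_at \<phi> (s, u)" for s
    unfolding weingarten_tangents[OF that]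
    using eigenvector_iff[OF tangents_independent[OF that]] by blast
  then show ?thesis
    unfolding line_of_curvature_def Let_def by (simp add: v)
qed

lemma ruling_line_of_curvature_iff:
  assumes "s \<in> I"
  shows "line_of_curvature \<phi> UNIV (\<lambda>u. (s, u)) \<longleftrightarrow> (\<forall>u. regular_at \<phi> (s, u) \<longrightarrow> B1 (s, u) = 0)"
proof -
  have v: "vector_derivative (\<phi> \<circ> (\<lambda>u. (s, u))) (at u) = q s" for u
    using phi_curve_u by (simp add: o_def vector_derivative_at)
  have "q s \<noteq> 0 \<and> (\<exists>l. weingarten \<phi> (s, u) (q s) = l *\<^sub>R q s) \<longleftrightarrow> B1 (s, u) = 0"
    if "regular_at \<phi> (s, u)" for u
    unfolding weingarten_tangents[OF assms that]
    using eigenvector_iff[OF tangents_independent[OF assms that]] by blast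
  then show ?thesis
    unfolding line_of_curvature_def Let_def v by simp
qed

section \<open>Planes and tangent surfaces\<close>

text \<open>
  If \<open>sin \<theta> \<noteq> 0\<close>, then the point \<open>u = 0\<close> of the ruling is regular, since \<open>f = sin \<theta>\<close> there; if
  \<open>sin \<theta> = 0\<close>, then \<open>\<mu>\<close> vanishes by definition.
\<close>

lemma B1_zero_iff_mu_zero:
  assumes s: "s \<in> I"
  shows "(\<forall>u. regular_at \<phi> (s, u) \<longrightarrow> B1 (s, u) = 0) \<longleftrightarrow> \<mu> s = 0"
proof
  assume B1: "\<forall>u. regular_at \<phi> (s, u) \<longrightarrow> B1 (s, u) = 0"
  show "\<mu> s = 0"
  proof (cases "sin (\<theta> s) = 0")
    case True
    then show ?thesis by (simp add: mu)
  next
    case False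
    then have "regular_at \<phi> (s, 0)"
      by (simp add: regular_iff[OF s] f_apply g_apply)
    then show ?thesis
      using B1 B1_eq[OF s] regular_iff[OF s] False by fastforce
  qed
qed (simp add: B1_eq[OF s])

end

lemma tangent_case_mu_zero:
  assumes "tangent_case J \<theta>" "s \<in> J"
  shows "\<mu> s = 0"
  using assms unfolding tangent_case_def mu by (auto simp: sin_zero_iff_int2)

text \<open>
  The unit normal of a plane takes only two opposite values, so by continuity it is constant near a
  regular point. Its derivative along the ruling vanishes, and the formula for this derivative
  forces \<open>\<mu> sin \<theta> = 0\<close>.
\<close>

lemma plane_mu_zero:
  assumes J: "open J" "J \<subseteq> I" and plane: "is_plane_over J \<phi>" and s: "s \<in> J"
  shows "\<mu> s = 0"
proof (cases "sin (\<theta> s) = 0")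
  case False
  have sI: "s \<in> I"
    using s J by blast
  have reg: "regular_at \<phi> (s, 0)"
    using False by (simp add: regular_iff[OF sI] f_apply g_apply)
  then have normal_ne: "normal_field (s, 0) \<noteq> 0"
    by (simp add: regular_iff_normal_field sI)
  obtain m where m: "\<And>p. fst p \<in> J \<Longrightarrow> regular_at \<phi> p \<Longrightarrow> unit_normal \<phi> p = m \<or> unit_normal \<phi> p = - m"
    using plane unfolding is_plane_over_def by blast
  define U0 where "U0 = unit_normal \<phi> (s, 0)"
  have norm_U0: "norm U0 = 1"
    using reg unfolding U0_def unit_normal_def regular_at_def by (simp add: norm_sgn)
  have pm: "unit_normal \<phi> p = U0 \<or> unit_normal \<phi> p = - U0" if "fst p \<in> J" "regular_at \<phi> p" for p
    using m[OF that] m[of "(s, 0)"] s reg unfolding U0_def by auto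
  note D = unit_normal_has_derivative[OF sI reg]
  have "\<forall>\<^sub>F p in at (s, 0). dist (unit_normal \<phi> p) U0 < 1"
    using has_derivative_continuous[OF D] unfolding U0_def continuous_at tendsto_iff by auto
  \<comment> \<open>Nearby points are regular: their normal field is closer to the one at \<open>(s, 0)\<close> than zero is.\<close>
  moreover have "\<forall>\<^sub>F p in at (s, 0). dist (normal_field p) (normal_field (s, 0)) < norm (normal_field (s, 0))"
    using has_derivative_continuous[OF normal_field_has_derivative[OF sI]] normal_ne
    unfolding continuous_at tendsto_iff by auto
  moreover have "\<forall>\<^sub>F p in at (s, 0). p \<in> J \<times> UNIV"
    by (rule eventually_at_in_open') (use J s in \<open>auto simp: open_Times\<close>)
  ultimately have "\<forall>\<^sub>F p in at (s, 0). unit_normal \<phi> p = U0"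
  proof eventually_elim
    case (elim p)
    then have p: "fst p \<in> J" "fst p \<in> I"
      using J by auto
    have "normal_field p \<noteq> 0"
      using elim by auto
    then have "regular_at \<phi> p"
      using p(2) by (simp add: regular_iff_normal_field)
    \<comment> \<open>The opposite value is excluded because opposite unit vectors have distance 2.\<close>
    moreover have "dist (- U0) U0 = 2"
    proof -
      have "- U0 - U0 = (- 2) *\<^sub>R U0"
        by (simp add: vec_eq_iff)
      then show ?thesis
        using norm_U0 unfolding dist_norm by (simp only: norm_scaleR)
    qed
    ultimately show ?case
      using pm[OF p(1)] elim by auto
  qed
  then have "((\<lambda>p. U0) has_derivative frechet_derivative (unit_normal \<phi>) (at (s, 0))) (at (s, 0))"
    using has_derivative_transform_eventually[OF D[unfolded frechet_derivative_at[OF D]]]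
    by (simp add: U0_def)
  then have "frechet_derivative (unit_normal \<phi>) (at (s, 0)) = (\<lambda>_. 0)"
    by (rule has_derivative_unique[OF _ has_derivative_const])
  then have zero: "0 *\<^sub>R tangent_s s 0 + 0 *\<^sub>R q s =
      (- (\<mu> s * sin (\<theta> s) / (sqrt ((f s 0)\<^sup>2 + (g s 0)\<^sup>2)) ^ 3)) *\<^sub>R tangent_s s 0
       + (\<mu> s * cos (\<theta> s) * sin (\<theta> s) / (sqrt ((f s 0)\<^sup>2 + (g s 0)\<^sup>2)) ^ 3) *\<^sub>R q s"
    using unit_normal_partials(2)[OF sI reg refl refl] by simp
  have "\<mu> s * sin (\<theta> s) / (sqrt ((f s 0)\<^sup>2 + (g s 0)\<^sup>2)) ^ 3 = 0"
    using cross3_nonzero_coeffs_unique(1)[OF tangents_independent[OF sI reg] zero] by simp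
  then show ?thesis
    using False reg regular_iff[OF sI] by auto
qed (simp add: mu)

text \<open>
  Without torsion \<open>B' = 0\<close>, so \<open>B\<close> is a constant vector, and \<open>g = 0\<close> leaves \<open>f B\<close> as normal field. The
  factor \<open>f\<close> may change sign across the singular locus, hence the two possible values.
\<close>

lemma torsion_zero_plane:
  assumes J: "is_interval J" "J \<subseteq> I" and zero: "\<And>s. s \<in> J \<Longrightarrow> \<tau> s = 0"
  shows "is_plane_over J \<phi>"
proof -
  have "convex J"
    using J(1) by (simp add: is_interval_convex)
  moreover have "(B has_vector_derivative 0) (at s within J)" if "s \<in> J" for s
    using frenet_equations(4)[of s] that J zero by (auto intro: has_vector_derivative_at_within)
  ultimately obtain b where b: "\<And>s. s \<in> J \<Longrightarrow> B s = b"
    using has_vector_derivative_zero_constant by metis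
  have "unit_normal \<phi> p = b \<or> unit_normal \<phi> p = - b" if p: "fst p \<in> J" "regular_at \<phi> p" for p
  proof -
    obtain s u where [simp]: "p = (s, u)" by (cases p)
    have s: "s \<in> J" "s \<in> I" using p J by auto
    have "g s u = 0" using zero[OF s(1)] by (simp add: g_apply mu)
    then have "f s u \<noteq> 0" "unit_normal \<phi> p = sgn (f s u) *\<^sub>R sgn (B s)"
      using p(2) regular_iff[OF s(2)] unit_normal_phi[of p] s(2)
      by (auto simp: normal_field_def sgn_scaleR)
    moreover have "sgn (B s) = b"
      using adapted_frame(3)[OF s(2)] b[OF s(1)] by (simp add: sgn_div_norm norm_eq_sqrt_inner)
    ultimately show ?thesis
      by (cases "f s u > 0") auto
  qed
  then show ?thesis
    unfolding is_plane_over_def by blast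
qed

lemma theta_continuous: "continuous_on I \<theta>"
  using theta_deriv by (meson DERIV_isCont continuous_at_imp_continuous_on)

text \<open>
  Different multiples of \<open>pi\<close> are at least \<open>pi\<close> apart, so a continuous function on an interval with
  such values is constant.
\<close>

lemma sin_zero_tangent_case:
  assumes J: "is_interval J" "J \<subseteq> I" and zero: "\<And>s. s \<in> J \<Longrightarrow> sin (\<theta> s) = 0"
  shows "tangent_case J \<theta>"
proof -
  have mult: "\<exists>k::int. \<theta> s = of_int k * pi" if "s \<in> J" for s
    using zero[OF that] sin_zero_iff_int2 by blast
  have "\<theta> constant_on J"
  proof (rule continuous_discrete_range_constant)
    show "connected J"
      using J(1) by (simp add: is_interval_connected)
    show "continuous_on J \<theta>"
      using theta_continuous J(2) continuous_on_subset by blast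
    show "\<exists>e>0. \<forall>t. t \<in> J \<and> \<theta> t \<noteq> \<theta> s \<longrightarrow> e \<le> norm (\<theta> t - \<theta> s)" if s: "s \<in> J" for s
    proof (intro exI[of _ pi] conjI allI impI)
      fix t assume t: "t \<in> J \<and> \<theta> t \<noteq> \<theta> s"
      obtain j k :: int where jk: "\<theta> s = of_int j * pi" "\<theta> t = of_int k * pi"
        using mult s t by blast
      then have "1 \<le> \<bar>k - j\<bar>"
        using t by auto
      then have "1 * pi \<le> of_int \<bar>k - j\<bar> * pi"
        by (intro mult_right_mono) (simp_all only: of_int_1_le_iff pi_ge_zero)
      also have "\<dots> = norm (\<theta> t - \<theta> s)"
        unfolding jk by (simp add: abs_mult flip: left_diff_distrib)
      finally show "pi \<le> norm (\<theta> t - \<theta> s)"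
        by simp
    qed simp
  qed
  then show ?thesis
    using mult unfolding constant_on_def tangent_case_def by (metis (full_types))
qed

lemma torsion_continuous: "continuous_on I \<tau>"
  using torsion_differentiable
  by (meson continuous_at_imp_continuous_on differentiable_imp_continuous_within)

text \<open>
  If \<open>\<tau>\<close> is the function that cannot vanish on a nonempty open set without vanishing everywhere,
  consider the open set where \<open>sin \<theta> \<noteq> 0\<close>: if it is empty, the surface is a tangent surface, and
  otherwise \<open>\<tau>\<close> vanishes on it, hence everywhere. The other case exchanges the two functions.
\<close>

lemma mu_zero_global:
  assumes analytic: "locally_zero_imp_zero I \<tau> \<or> locally_zero_imp_zero I (\<lambda>s. sin (\<theta> s))"
    and zero: "\<And>s. s \<in> I \<Longrightarrow> \<mu> s = 0"
  shows "is_plane_over I \<phi> \<or> tangent_case I \<theta>"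
proof -
  have mu0: "\<tau> s = 0 \<or> sin (\<theta> s) = 0" if "s \<in> I" for s
    using zero[OF that] by (simp add: mu)
  define K where "K = {s \<in> I. sin (\<theta> s) \<noteq> 0}"
  define L where "L = {s \<in> I. \<tau> s \<noteq> 0}"
  have "open K" "open L"
    unfolding K_def L_def
    by (intro nonzero_open open_I continuous_intros theta_continuous torsion_continuous)+
  have "(\<forall>s\<in>I. \<tau> s = 0) \<or> (\<forall>s\<in>I. sin (\<theta> s) = 0)"
    using analytic
  proof
    assume "locally_zero_imp_zero I \<tau>"
    moreover have "K \<subseteq> I" "\<forall>s\<in>K. \<tau> s = 0"
      using mu0 unfolding K_def by auto
    ultimately have "K = {} \<or> (\<forall>s\<in>I. \<tau> s = 0)"
      using \<open>open K\<close> unfolding locally_zero_imp_zero_def by blast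
    then show ?thesis
      unfolding K_def by auto
  next
    assume "locally_zero_imp_zero I (\<lambda>s. sin (\<theta> s))"
    moreover have "L \<subseteq> I" "\<forall>s\<in>L. sin (\<theta> s) = 0"
      using mu0 unfolding L_def by auto
    ultimately have "L = {} \<or> (\<forall>s\<in>I. sin (\<theta> s) = 0)"
      using \<open>open L\<close> unfolding locally_zero_imp_zero_def by blast
    then show ?thesis
      unfolding L_def by auto
  qed
  then show ?thesis
    using torsion_zero_plane[OF interval_I subset_refl] sin_zero_tangent_case[OF interval_I subset_refl]
    by blast
qed

text \<open>
  Suppose \<open>\<mu> = 0\<close>. On a nonempty open set \<open>K\<close> either \<open>sin \<theta> = 0\<close> throughout, or \<open>K\<close> contains an
  interval on which \<open>sin \<theta> \<noteq> 0\<close> and thus \<open>\<tau> = 0\<close>. Conversely, if \<open>\<mu>\<close> had a nonzero value, then the open set where \<open>\<mu> \<noteq> 0\<close> would contain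
  an interval of one of the two kinds, on which \<open>\<mu> = 0\<close>.
\<close>

lemma mu_zero_dense:
  "(\<forall>s\<in>I. \<mu> s = 0) \<longleftrightarrow>
    (\<forall>K. open K \<and> K \<noteq> {} \<and> K \<subseteq> I \<longrightarrow>
       (\<exists>J. open J \<and> is_interval J \<and> J \<noteq> {} \<and> J \<subseteq> K \<and> (is_plane_over J \<phi> \<or> tangent_case J \<theta>)))"
    (is "?L \<longleftrightarrow> ?R")
proof
  assume zero: ?L
  show ?R
  proof (intro allI impI, elim conjE)
    fix K :: "real set"
    assume K: "open K" "K \<noteq> {}" "K \<subseteq> I"
    have ball: "\<exists>J. open J \<and> is_interval J \<and> J \<noteq> {} \<and> J \<subseteq> M" if "open M" "M \<noteq> {}" for M :: "real set"
    proof -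
      obtain x e where "e > 0" "ball x e \<subseteq> M"
        using \<open>open M\<close> \<open>M \<noteq> {}\<close> by (meson ex_in_conv open_contains_ball)
      then show ?thesis
        by (intro exI[of _ "ball x e"]) (auto simp: is_interval_convex_1)
    qed
    define M where "M = {s \<in> K. sin (\<theta> s) \<noteq> 0}"
    have M: "open M"
      unfolding M_def using K theta_continuous
      by (intro nonzero_open continuous_intros) (auto intro: continuous_on_subset)
    show "\<exists>J. open J \<and> is_interval J \<and> J \<noteq> {} \<and> J \<subseteq> K \<and> (is_plane_over J \<phi> \<or> tangent_case J \<theta>)"
    proof (cases "M = {}")
      case True
      obtain J where J: "open J" "is_interval J" "J \<noteq> {}" "J \<subseteq> K"
        using ball K by blast
      then have "tangent_case J \<theta>"
        using True K(3) unfolding M_def by (intro sin_zero_tangent_case) auto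
      with J show ?thesis by blast
    next
      case False
      obtain J where J: "open J" "is_interval J" "J \<noteq> {}" "J \<subseteq> M"
        using ball M False by blast
      then have "J \<subseteq> K" unfolding M_def by blast
      moreover have "\<tau> s = 0" if "s \<in> J" for s
        using zero that J(4) K(3) unfolding M_def mu by auto
      then have "is_plane_over J \<phi>"
        using J(2) \<open>J \<subseteq> K\<close> K(3) by (intro torsion_zero_plane) auto
      ultimately show ?thesis using J by blast
    qed
  qed
next
  assume R: ?R
  define K where "K = {s \<in> I. \<mu> s \<noteq> 0}"
  have "continuous_on I \<mu>"
    using mu_differentiable by (meson DERIV_isCont continuous_at_imp_continuous_on)
  then have "open K"
    unfolding K_def by (rule nonzero_open[OF open_I])
  have "K = {}"
  proof (rule ccontr)
    assume "K \<noteq> {}"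
    moreover have "K \<subseteq> I" unfolding K_def by blast
    ultimately obtain J where J: "open J" "J \<noteq> {}" "J \<subseteq> K" "is_plane_over J \<phi> \<or> tangent_case J \<theta>"
      using R \<open>open K\<close> by meson
    have "\<mu> s = 0" if "s \<in> J" for s
      using J \<open>K \<subseteq> I\<close> plane_mu_zero[of J s] tangent_case_mu_zero[of J s] that by blast
    then show False
      using J(2,3) unfolding K_def by blast
  qed
  then show ?L
    unfolding K_def by blast
qed

end

theorem corollary3p15:
  fixes I :: "real set"
    and \<alpha> T N B :: "real \<Rightarrow> real^3"
    and \<kappa> \<tau> \<theta> \<eta> \<mu> \<xi> :: "real \<Rightarrow> real"
    and f g :: "real \<Rightarrow> real \<Rightarrow> real"
    and A1 A2 B1 B2 :: "real \<times> real \<Rightarrow> real"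
    and \<phi> :: "real \<times> real \<Rightarrow> real^3"
  assumes frenet: "frenet_curve I \<alpha> T N B \<kappa> \<tau>"
    and theta: "smooth_on I \<theta>"
    and not_line: "tangent_case I \<theta> \<longrightarrow> (\<exists>s\<in>I. \<kappa> s \<noteq> 0)"
    and phi: "\<phi> = ot_ruled_surface \<alpha> T N \<theta>"
    and coeffs: "weingarten_coeffs \<phi> I A1 A2 B1 B2"
    and eta: "\<eta> = (\<lambda>s. deriv \<theta> s + \<kappa> s)"
    and mu: "\<mu> = (\<lambda>s. \<tau> s * sin (\<theta> s))"
    and xi: "\<xi> = (\<lambda>s. \<tau> s * cos (\<theta> s))"
    and f: "f = (\<lambda>s u. sin (\<theta> s) - u * \<eta> s)"
    and g: "g = (\<lambda>s u. u * \<mu> s)"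
  shows
    "\<comment> \<open>(i)\<close>
     (\<forall>u0.
       (line_of_curvature \<phi> I (\<lambda>s. (s, u0)) \<longleftrightarrow>
          (\<forall>s\<in>I. regular_at \<phi> (s, u0) \<longrightarrow> A2 (s, u0) = 0)) \<and>
       ((\<forall>s\<in>I. regular_at \<phi> (s, u0) \<longrightarrow> A2 (s, u0) = 0) \<longleftrightarrow>
          (\<forall>s\<in>I. ((f s u0)\<^sup>2 + (g s u0)\<^sup>2) * (f s u0 * \<mu> s + g s u0 * \<eta> s + \<xi> s * cos (\<theta> s))
                 + cos (\<theta> s) * (g s u0 * deriv (\<lambda>t. f t u0) s - f s u0 * deriv (\<lambda>t. g t u0) s) = 0))) \<and>
     \<comment> \<open>(ii): the individual rulings\<close>
     (\<forall>s0\<in>I. line_of_curvature \<phi> UNIV (\<lambda>u. (s0, u)) \<longleftrightarrow>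
          (\<forall>u. regular_at \<phi> (s0, u) \<longrightarrow> B1 (s0, u) = 0)) \<and>
     \<comment> \<open>(ii): planes and tangent surfaces, globally\<close>
     (is_plane_over I \<phi> \<or> tangent_case I \<theta> \<longrightarrow>
          (\<forall>s\<in>I. \<forall>u. regular_at \<phi> (s, u) \<longrightarrow> B1 (s, u) = 0)) \<and>
     (locally_zero_imp_zero I \<tau> \<or> locally_zero_imp_zero I (\<lambda>s. sin (\<theta> s)) \<longrightarrow>
          ((\<forall>s\<in>I. \<forall>u. regular_at \<phi> (s, u) \<longrightarrow> B1 (s, u) = 0) \<longleftrightarrow>
           is_plane_over I \<phi> \<or> tangent_case I \<theta>)) \<and>
     \<comment> \<open>(ii): without restriction on torsion or angle, on a dense family of open subintervals\<close>
     ((\<forall>s\<in>I. \<forall>u. regular_at \<phi> (s, u) \<longrightarrow> B1 (s, u) = 0) \<longleftrightarrow>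
          (\<forall>K. open K \<and> K \<noteq> {} \<and> K \<subseteq> I \<longrightarrow>
             (\<exists>J. open J \<and> is_interval J \<and> J \<noteq> {} \<and> J \<subseteq> K \<and>
                  (is_plane_over J \<phi> \<or> tangent_case J \<theta>))))"
proof -
  interpret ot_surface I \<alpha> T N B \<kappa> \<tau> \<theta> \<eta> \<mu> \<xi> f g \<phi>
    by (rule ot_surface.intro) (rule frenet theta phi eta mu xi f g)+
  have B1: "(\<forall>s\<in>I. \<forall>u. regular_at \<phi> (s, u) \<longrightarrow> B1 (s, u) = 0) \<longleftrightarrow> (\<forall>s\<in>I. \<mu> s = 0)"
    using B1_zero_iff_mu_zero[OF coeffs] by blast
  have mu_zero: "\<forall>s\<in>I. \<mu> s = 0" if "is_plane_over I \<phi> \<or> tangent_case I \<theta>"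
    using that plane_mu_zero[OF open_I subset_refl] tangent_case_mu_zero by blast
  show ?thesis
    unfolding B1
    by (intro conjI allI ballI impI base_curve_line_of_curvature_iff[OF coeffs]
        ball_cong refl A2_zero_iff[OF coeffs] ruling_line_of_curvature_iff[OF coeffs] mu_zero_dense)
       (use mu_zero mu_zero_global in blast)+
qed

end
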